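(* Suppose that the pair $(A,C)$ is observable and that the eigenvalues of $A-LC$ are (real) negative and simple. Let $\widetilde\gamma>0$ be arbitrary, and assume that for every integer $\ell\ge1$ the jumps of the time-parallelized observer satisfy $$\gamma\sum_{n=1}^{N-1} e^{\mu n\Delta T}\|J_{\ell,n}^{h}\| \leq \widetilde{\gamma}\, \frac{e^{-\mu (\ell-1) T }}{2^\ell}.$$ Then the rate of convergence of $\hat x_\parallel$ to $x$ is bounded by $\mu$, in the sense that, with $\varepsilon_\parallel(t):=x(t)-\hat x_\parallel(t)$, for every $\ell\ge1$, $$\|\varepsilon_{\parallel}( T_{\ell})\| \leq \gamma \left(\|x(0) -\hat{x}_0\| +\widetilde{\gamma}\right)e^{-\mu \ell T}.$$
   Context: Norms are Euclidean norms of vectors and induced 2-norms of matrices. Let $A\in\mathbb{R}^{m\times m}$, $B\in\mathbb{R}^{m\times p}$, $C\in\mathbb{R}^{q\times m}$, $L\in\mathbb{R}^{m\times q}$, and let $u:(0,\infty)\to\mathbb{R}^p$ be a given input (regular enough for the linear ODEs below to be well posed). The true state $x$ and output $y$ satisfy $\dot x(t)=Ax(t)+Bu(t)$, $x(0)=x_0$, $y(t)=Cx(t)$. The system is observable if the matrix obtained by stacking $C,CA,\dots,CA^{m-1}$ has rank $m$. The vector $\hat x_0\in\mathbb{R}^m$ is an arbitrary initial condition for the observer (the Luenberger observer solves $\dot{\hat x}=A\hat x+Bu+L(y-C\hat x)$, $\hat x(0)=\hat x_0$). Put $\mu:=\min_{\nu\in\sigma(A-LC)}|\nu|$ and $\gamma:=\mathrm{cond}(V)=\|V^{-1}\|\,\|V\|$,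 where $V$ is a fixed invertible matrix whose columns are eigenvectors of $A-LC$. Time-parallelized observer: let $T>0$, $N\ge1$ an integer, $\Delta T=T/N$, $T_\ell=\ell T$ for $\ell\ge 0$, and for $\ell\ge1$, $0\le n\le N$, $t_n^\ell=T_{\ell-1}+n\Delta T$. The window $W_\ell=(T_{\ell-1},T_\ell)$ is split into the subintervals $(t_n^\ell,t_{n+1}^\ell)$, $0\le n\le N-1$. For each $\ell\ge1$ let vectors $\hat X^h_{\ell,n}\in\mathbb{R}^m$, $1\le n\le N-1$, be given (produced by any time-parallel procedure whose accuracy is indicated by $h$, which may depend on the window). On each $(t_n^\ell,t_{n+1}^\ell)$, $\hat x_\parallel$ solves $\dot{\hat x}_\parallel(t)=A\hat x_\parallel(t)+Bu(t)+L[y(t)-C\hat x_\parallel(t)]$ with $\hat x_\parallel(t_n^{\ell+})=\hat X^h_{\ell,n}$, where for $n=0$ one takes $\hat X^h_{1,0}=\hat x_0$ and $\hat X^h_{\ell,0}=\hat x_\parallel(T_{\ell-1}^-)$ for $\ell\ge2$; thus $\hat x_\parallel$ is continuous at each $T_\ell$ and $\hat x_\parallel(0)=\hat x_0$. The superscripts $\pm$ denote right/left limits. The jumps are $J^h_{\ell,n}:=\hat X^h_{\ell,n}-\hat x_\parallel(t_n^{\ell-})$, $1\le n\le N-1$. *)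

theory Defs
  imports "HOL-Analysis.Analysis" "HOL-Computational_Algebra.Polynomial"
begin

section \<open>Observability\<close>

text \<open>On vectors of vectors \<open>(^)\<close> is the componentwise power, hence the iteration of \<open>(**)\<close>.\<close>

definition matpow :: "'a::semiring_1 ^ 'n ^ 'n \<Rightarrow> nat \<Rightarrow> 'a ^ 'n ^ 'n" where
  "matpow M k = (((**) M) ^^ k) (mat 1)"

text \<open>
  The matrix obtained by stacking \<open>C, CA, \<dots>, CA\<^sup>m\<^sup>-\<^sup>1\<close>, where \<open>m = CARD('m)\<close>. Its rows are indexed by
  pairs \<open>(k, i)\<close>, denoting row \<open>i\<close> of the block whose exponent is the number of \<open>k\<close> in an
  enumeration of \<open>'m\<close>: \<open>to_nat_on UNIV\<close> is a bijection from \<open>'m\<close> onto \<open>{0, \<dots>, m - 1}\<close>.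
\<close>

definition observability_matrix ::
  "real ^ 'm ^ 'm \<Rightarrow> real ^ 'm ^ 'q \<Rightarrow> real ^ 'm ^ ('m \<times> 'q)" where
  "observability_matrix A C =
    (\<chi> r. (C ** matpow A (to_nat_on (UNIV :: 'm set) (fst r))) $ snd r)"

definition observable :: "real ^ 'm ^ 'm \<Rightarrow> real ^ 'm ^ 'q \<Rightarrow> bool" where
  "observable (A :: real ^ 'm ^ 'm) C \<longleftrightarrow> rank (observability_matrix A C) = CARD('m)"


section \<open>Spectrum and condition number\<close>

definition complex_matrix :: "real ^ 'n ^ 'm \<Rightarrow> complex ^ 'n ^ 'm" where
  "complex_matrix M = (\<chi> i j. complex_of_real (M $ i $ j))"

definition eigenvector :: "'a::field ^ 'n ^ 'n \<Rightarrow> 'a \<Rightarrow> 'a ^ 'n \<Rightarrow> bool" where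
  "eigenvector M \<nu> v \<longleftrightarrow> v \<noteq> 0 \<and> M *v v = \<nu> *s v"

definition spectrum :: "real ^ 'n ^ 'n \<Rightarrow> complex set" where
  "spectrum M = {\<nu>. \<exists>v. eigenvector (complex_matrix M) \<nu> v}"

definition charpoly :: "'a::comm_ring_1 ^ 'n ^ 'n \<Rightarrow> 'a poly" where
  "charpoly M = det (mat [:0, 1:] - (\<chi> i j. [:M $ i $ j:]))"

text \<open>Simple means algebraic multiplicity one.\<close>

definition simple_eigenvalue :: "real ^ 'n ^ 'n \<Rightarrow> complex \<Rightarrow> bool" where
  "simple_eigenvalue M \<nu> \<longleftrightarrow>
    \<nu> \<in> spectrum M \<and> Polynomial.order \<nu> (charpoly (complex_matrix M)) = 1"

text \<open>\<open>onorm ((*v) V)\<close> is the matrix norm induced by the Euclidean vector norms.\<close>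

definition cond :: "complex ^ 'n ^ 'n \<Rightarrow> real" where
  "cond V = onorm ((*v) (matrix_inv V)) * onorm ((*v) V)"


section \<open>The differential equations\<close>

text \<open>
  A continuous \<open>z\<close> with \<open>z' t = f t (z t)\<close> on the open set \<open>I\<close>. The equation may fail on a countable
  set, so that inputs with jumps (for instance piecewise continuous ones) are admitted besides the
  continuous ones, for which the solutions are the classical ones.
\<close>

definition solves_on ::
  "(real \<Rightarrow> 'a \<Rightarrow> 'a) \<Rightarrow> (real \<Rightarrow> 'a::real_normed_vector) \<Rightarrow> real set \<Rightarrow> bool" where
  "solves_on f z I \<longleftrightarrow> continuous_on I z \<and>
    (\<exists>E. countable E \<and> (\<forall>t \<in> I - E. (z has_vector_derivative f t (z t)) (at t)))"

text \<open>The input \<open>u\<close> is only relevant on \<open>(0, \<infinity>)\<close>.\<close>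

definition system_solution ::
  "real ^ 'm ^ 'm \<Rightarrow> real ^ 'p ^ 'm \<Rightarrow> (real \<Rightarrow> real ^ 'p) \<Rightarrow> real ^ 'm \<Rightarrow> (real \<Rightarrow> real ^ 'm) \<Rightarrow> bool"
  where
  "system_solution A B u x0 x \<longleftrightarrow>
    solves_on (\<lambda>t z. A *v z + B *v u t) x {0<..} \<and> x 0 = x0 \<and> (x \<longlongrightarrow> x0) (at_right 0)"

text \<open>The node \<open>t\<^sub>n\<^sup>\<ell> = T\<^sub>\<ell>\<^sub>-\<^sub>1 + n \<Delta>T\<close>, with \<open>T\<^sub>\<ell> = \<ell> T\<close> and \<open>\<Delta>T = T / N\<close>.\<close>

definition node :: "real \<Rightarrow> nat \<Rightarrow> nat \<Rightarrow> nat \<Rightarrow> real" where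
  "node T N l n = (real l - 1) * T + real n * (T / real N)"

text \<open>
  \<open>X l n\<close> is the initial value on the \<open>n\<close>-th subinterval of window \<open>l\<close>; it is arbitrary for
  \<open>1 \<le> n \<le> N - 1\<close>. The values of \<open>xp\<close> at the nodes interior to a window are left unspecified, only
  its one-sided limits there matter.
\<close>

definition parallel_observer ::
  "real ^ 'm ^ 'm \<Rightarrow> real ^ 'p ^ 'm \<Rightarrow> real ^ 'm ^ 'q \<Rightarrow> real ^ 'q ^ 'm \<Rightarrow>
   (real \<Rightarrow> real ^ 'p) \<Rightarrow> (real \<Rightarrow> real ^ 'q) \<Rightarrow> real \<Rightarrow> nat \<Rightarrow> real ^ 'm \<Rightarrow>
   (nat \<Rightarrow> nat \<Rightarrow> real ^ 'm) \<Rightarrow> (real \<Rightarrow> real ^ 'm) \<Rightarrow> bool" where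
  "parallel_observer A B C L u y T N xh0 X xp \<longleftrightarrow>
    (\<forall>l\<ge>1. \<forall>n<N.
      solves_on (\<lambda>t z. A *v z + B *v u t + L *v (y t - C *v z)) xp
        {node T N l n <..< node T N l (Suc n)} \<and>
      (xp \<longlongrightarrow> X l n) (at_right (node T N l n))) \<and>
    X 1 0 = xh0 \<and>
    (\<forall>l\<ge>2. X l 0 = Lim (at_left (real (l - 1) * T)) xp) \<and>
    xp 0 = xh0 \<and>
    (\<forall>l\<ge>1. isCont xp (real l * T))"

definition jump ::
  "real \<Rightarrow> nat \<Rightarrow> (nat \<Rightarrow> nat \<Rightarrow> real ^ 'm) \<Rightarrow> (real \<Rightarrow> real ^ 'm) \<Rightarrow> nat \<Rightarrow> nat \<Rightarrow> real ^ 'm" where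
  "jump T N X xp l n = X l n - Lim (at_left (node T N l n)) xp"

end

theory Submission
  imports Defs
begin

text \<open>
  Put \<open>\<epsilon> = x - xp\<close>. Between two nodes the input cancels and \<open>\<epsilon>\<close> solves
  \<open>\<epsilon>' = (A - L C) \<epsilon>\<close>; at an interior node \<open>\<epsilon>\<close> jumps by \<open>- J\<close>. The idea is to measure \<open>\<epsilon>\<close> in
  the norm \<open>\<parallel>V\<inverse> \<epsilon>\<parallel>\<close> of its eigenvector coordinates. There the equation decouples into scalar ones
  with rates \<open>\<nu> \<le> - \<mu>\<close>, so a flow over a time \<open>s\<close> multiplies the norm by at most \<open>exp (- \<mu> s)\<close>,
  with constant \<open>1\<close>, no matter how many subintervals are concatenated
  (\<open>linear_ode_contraction\<close>, \<open>observer_error_contraction\<close>), while a jump adds at most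
  \<open>\<parallel>V\<inverse>\<parallel> \<parallel>J\<parallel>\<close>.

  Iterating over the subintervals of a window (\<open>observer_error_window\<close>) and then over the windows
  bounds \<open>exp (\<mu> l T) \<parallel>V\<inverse> \<epsilon> (l T)\<parallel>\<close> by \<open>\<parallel>V\<inverse> \<epsilon> 0\<parallel>\<close> plus the jumps weighted by the exponential of
  the time elapsed. Only now is the Euclidean norm restored, at the cost of one factor \<open>\<parallel>V\<parallel>\<close>: the
  initial term becomes \<open>\<gamma> \<parallel>\<epsilon> 0\<parallel>\<close>, and the hypothesis on the jumps makes the contribution of window
  \<open>k\<close> at most \<open>\<gamma>' / 2 ^ k\<close>. These sum to at most \<open>\<gamma>' \<le> \<gamma> \<gamma>'\<close>, since a condition number is at
  least \<open>1\<close>.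

  Solutions may fail to be differentiable at countably many times, so the explicit solution of the
  scalar equations rests on the fact that a continuous function whose derivative vanishes off a
  countable set is constant (\<open>zero_derivative_off_countable_imp_eq\<close>).
\<close>

section \<open>Functions with vanishing derivative off a countable set\<close>

text \<open>
  Tilting by \<open>e * t\<close> makes the derivative strictly positive. If the tilted function still decreased
  from \<open>a\<close> to \<open>b\<close>, it would pass downwards through an interval of levels; the exceptional set
  only has countably many values, so some level avoids them all, and at its last crossing the
  derivative exists and is positive, which is absurd.
\<close>

lemma nonneg_derivative_off_countable_imp_le:
  fixes f f' :: "real \<Rightarrow> real"
  assumes ab: "a \<le> b" and cont: "continuous_on {a..b} f" and E: "countable E"
    and der: "\<And>t. t \<in> {a..b} - E \<Longrightarrow> (f has_real_derivative f' t) (at t)"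
    and nonneg: "\<And>t. t \<in> {a..b} - E \<Longrightarrow> 0 \<le> f' t"
  shows "f a \<le> f b"
proof (rule ccontr)
  assume "\<not> f a \<le> f b"
  then have less: "f b < f a" and "a < b"
    using ab by (auto simp: less_le)
  \<comment> \<open>This slope makes up for exactly half of the drop, so that the tilted function still drops.\<close>
  define e where "e = (f a - f b) / (2 * (b - a))"
  have e: "0 < e" "e * (b - a) = (f a - f b) / 2"
    using less \<open>a < b\<close> by (auto simp: e_def field_simps)
  define h where "h t = f t + e * t" for t
  have conth: "continuous_on {a..b} h"
    unfolding h_def by (intro continuous_intros cont)
  have "h b < h a"
    using e(2) less by (simp add: h_def algebra_simps)
  moreover have "countable (h ` E)"
    using E by simp
  ultimately obtain c where c: "h b < c" "c < h a" "c \<notin> h ` E"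
    using uncountable_open_interval[of "h b" "h a"]
    by (metis countable_subset greaterThanLessThan_iff subsetI)
  define S where "S = {t \<in> {a..b}. c \<le> h t}"
  have "closed S"
    using continuous_on_closed_Collect_le[OF continuous_on_const conth closed_atLeastAtMost]
    by (simp add: S_def)
  moreover have "a \<in> S" and bdd: "bdd_above S"
    using c ab by (auto simp: S_def)
  ultimately have S: "Sup S \<in> S"
    using closed_contains_Sup by blast
  define s where "s = Sup S"
  have s: "a \<le> s" "s < b" "c \<le> h s"
    using S c by (auto simp: S_def s_def less_le)
  have after: "h t < c" if "s < t" "t \<le> b" for t
    using that s cSup_upper[OF _ bdd, of t] by (force simp: S_def s_def)
  have "h s = c"
  proof (rule ccontr)
    assume "h s \<noteq> c"
    then have "c < h s"
      using s by simp
    moreover have "continuous_on {s..b} h"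
      by (rule continuous_on_subset[OF conth]) (use s in auto)
    ultimately obtain t where "s \<le> t" "t \<le> b" "h t = c"
      using IVT2'[of h b c s] s c by auto
    then show False
      using after[of t] \<open>c < h s\<close> by (cases "t = s") auto
  qed
  then have "s \<notin> E"
    using c by auto
  then have "(h has_real_derivative f' s + e) (at s)" "0 < f' s + e"
    using der[of s] nonneg[of s] s e(1) unfolding h_def
    by (auto intro!: derivative_eq_intros)
  then obtain d where d: "d > 0" "\<And>r. 0 < r \<Longrightarrow> r < d \<Longrightarrow> h s < h (s + r)"
    using DERIV_pos_inc_right by blast
  define r where "r = min (d / 2) (b - s)"
  have "h s < h (s + r)"
    using d s by (intro d(2)) (auto simp: r_def)
  moreover have "h (s + r) < c"
    using d s by (intro after) (auto simp: r_def)
  ultimately show False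
    using \<open>h s = c\<close> by simp
qed

text \<open>The scalar case applies to the component of \<open>g\<close> along its own increment.\<close>

lemma zero_derivative_off_countable_imp_eq:
  fixes g :: "real \<Rightarrow> 'a::real_inner"
  assumes ab: "a \<le> b" and cont: "continuous_on {a..b} g" and E: "countable E"
    and der: "\<And>t. t \<in> {a..b} - E \<Longrightarrow> (g has_vector_derivative 0) (at t)"
  shows "g a = g b"
proof -
  define v where "v = g a - g b"
  have "g a \<bullet> v \<le> g b \<bullet> v"
  proof (rule nonneg_derivative_off_countable_imp_le[OF ab _ E, where f' = "\<lambda>_. 0"])
    show "continuous_on {a..b} (\<lambda>t. g t \<bullet> v)"
      by (intro continuous_intros cont)
    show "((\<lambda>t. g t \<bullet> v) has_real_derivative 0) (at t)" if "t \<in> {a..b} - E" for t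
      using bounded_linear.has_vector_derivative[OF bounded_linear_inner_left der[OF that], of v]
      by (simp add: has_real_derivative_iff_has_vector_derivative)
  qed auto
  then have "v \<bullet> v \<le> 0"
    by (simp add: v_def inner_diff_left)
  then have "v = 0"
    using inner_ge_zero[of v] inner_eq_zero_iff[of v] by linarith
  then show ?thesis
    by (simp add: v_def)
qed

text \<open>
  The integrating factor \<open>exp (- \<nu> t)\<close> turns \<open>f\<close> into a function of derivative zero, whose
  constant value is read off from the right limit at \<open>a\<close>.
\<close>

lemma scalar_linear_ode_solution:
  fixes f :: "real \<Rightarrow> complex"
  assumes cont: "continuous_on {a<..<b} f" and E: "countable E"
    and der: "\<And>t. t \<in> {a<..<b} - E \<Longrightarrow> (f has_vector_derivative \<nu> * f t) (at t)"
    and lim: "(f \<longlongrightarrow> c) (at_right a)" and t: "t \<in> {a<..<b}"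
  shows "f t = exp (\<nu> * of_real (t - a)) * c"
proof -
  define g where "g s = exp (- \<nu> * of_real s) * f s" for s
  have const: "g s = g t" if s: "s \<in> {a<..<t}" for s
  proof (rule zero_derivative_off_countable_imp_eq[OF _ _ E])
    show "continuous_on {s..t} g"
      unfolding g_def using s t
      by (intro continuous_intros continuous_on_subset[OF cont]) auto
    fix r assume "r \<in> {s..t} - E"
    then have r: "(f has_vector_derivative \<nu> * f r) (at r)"
      using s t by (intro der) auto
    have "((\<lambda>s. exp (- \<nu> * of_real s)) has_vector_derivative - \<nu> * exp (- \<nu> * of_real r)) (at r)"
      by (rule has_vector_derivative_real_field) (auto intro!: derivative_eq_intros)
    from has_vector_derivative_mult[OF this r]
    show "(g has_vector_derivative 0) (at r)"
      unfolding g_def by (simp add: algebra_simps)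
  qed (use s in auto)
  have "\<forall>\<^sub>F s in at_right a. s \<in> {a<..<t}"
    using t by (intro eventually_at_right_real) auto
  then have "(g \<longlongrightarrow> g t) (at_right a)"
    by (intro tendsto_eventually) (erule eventually_mono, erule const)
  moreover have "(g \<longlongrightarrow> exp (- \<nu> * of_real a) * c) (at_right a)"
    unfolding g_def by (intro tendsto_intros lim)
  ultimately have "g t = exp (- \<nu> * of_real a) * c"
    by (intro tendsto_unique[of "at_right a" g]) auto
  then have "exp (\<nu> * of_real t) * g t = exp (\<nu> * of_real t) * (exp (- \<nu> * of_real a) * c)"
    by simp
  then show ?thesis
    by (simp add: g_def exp_diff exp_minus divide_inverse algebra_simps)
qed


section \<open>Eigenvector coordinates\<close>

definition complex_vector :: "real ^ 'n \<Rightarrow> complex ^ 'n" where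
  "complex_vector z = (\<chi> i. complex_of_real (z $ i))"

lemma norm_complex_vector [simp]: "norm (complex_vector z) = norm z"
  by (simp add: complex_vector_def norm_vec_def)

lemma bounded_linear_complex_vector: "bounded_linear complex_vector"
proof (rule bounded_linear_intro[where K = 1])
  show "complex_vector (r *\<^sub>R z) = r *\<^sub>R complex_vector z" for r and z :: "real ^ 'n"
    by (simp add: complex_vector_def vec_eq_iff) (simp add: scaleR_conv_of_real)
qed (simp_all, simp add: complex_vector_def vec_eq_iff)

lemma complex_matrix_mult_complex_vector:
  "complex_matrix M *v complex_vector z = complex_vector (M *v z)"
  by (simp add: complex_matrix_def complex_vector_def matrix_vector_mult_def vec_eq_iff)

lemma
  assumes "invertible V"
  shows matrix_inv_right: "V ** matrix_inv V = mat 1"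
    and matrix_inv_left: "matrix_inv V ** V = mat 1"
  using someI_ex[OF assms[unfolded invertible_def]] by (auto simp: matrix_inv_def)

lemma
  fixes V :: "complex ^ 'n ^ 'n"
  assumes "invertible V"
  shows mult_matrix_inv_cancel: "V *v (matrix_inv V *v z) = z"
    and matrix_inv_mult_cancel: "matrix_inv V *v (V *v z) = z"
  using assms by (simp_all add: matrix_vector_mul_assoc matrix_inv_right matrix_inv_left)

lemma eigenvector_coordinates:
  fixes V H :: "complex ^ 'n ^ 'n"
  assumes inv: "invertible V" and ev: "\<And>j. eigenvector H (\<nu> j) (column j V)"
  shows "(matrix_inv V *v (H *v z)) $ j = \<nu> j * (matrix_inv V *v z) $ j"
proof -
  define w where "w = matrix_inv V *v z"
  have "H *v z = H *v (V *v w)"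
    by (simp add: w_def mult_matrix_inv_cancel[OF inv])
  also have "\<dots> = (\<Sum>i\<in>UNIV. w $ i *s (H *v column i V))"
    by (simp add: matrix_mult_sum[of V] vec.linear_sum vec.linear_scale)
  also have "\<dots> = (\<Sum>i\<in>UNIV. (\<chi> i. \<nu> i * w $ i) $ i *s column i V)"
    using ev by (simp add: eigenvector_def mult.commute)
  also have "\<dots> = V *v (\<chi> i. \<nu> i * w $ i)"
    by (simp add: matrix_mult_sum[of V])
  finally show ?thesis
    by (simp add: matrix_inv_mult_cancel[OF inv] w_def)
qed

text \<open>
  An eigenvector has a nonzero coordinate, and that coordinate identifies its eigenvalue. In
  particular the spectrum is finite, so that a minimum over it is attained.
\<close>

lemma spectrum_eq_range:
  fixes M :: "real ^ 'n ^ 'n" and V :: "complex ^ 'n ^ 'n"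
  assumes inv: "invertible V" and ev: "\<And>j. eigenvector (complex_matrix M) (\<nu> j) (column j V)"
  shows "spectrum M = range \<nu>"
proof (intro equalityI subsetI)
  fix k assume "k \<in> spectrum M"
  then obtain v where v: "v \<noteq> 0" "complex_matrix M *v v = k *s v"
    by (auto simp: spectrum_def eigenvector_def)
  have "matrix_inv V *v v \<noteq> 0"
    using v(1) mult_matrix_inv_cancel[OF inv, of v] by (metis matrix_vector_mult_0_right)
  then obtain j where j: "(matrix_inv V *v v) $ j \<noteq> 0"
    by (auto simp: vec_eq_iff)
  have "k * (matrix_inv V *v v) $ j = \<nu> j * (matrix_inv V *v v) $ j"
    using eigenvector_coordinates[OF inv ev, of v j] by (simp add: v(2) vec.linear_scale)
  then show "k \<in> range \<nu>"
    using j by auto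
qed (use ev in \<open>auto simp: spectrum_def\<close>)

lemma norm_matrix_vector_le:
  fixes V :: "complex ^ 'n ^ 'm"
  shows "norm (V *v z) \<le> onorm ((*v) V) * norm z"
  by (intro onorm matrix_vector_mul_bounded_linear)

lemma cond_ge_1:
  fixes V :: "complex ^ 'n ^ 'n"
  assumes inv: "invertible V"
  shows "1 \<le> cond V"
proof -
  define z :: "complex ^ 'n" where "z = axis undefined 1"
  have "0 < norm z"
    by (simp add: z_def)
  have "norm z \<le> onorm ((*v) (matrix_inv V)) * norm (V *v z)"
    using norm_matrix_vector_le[of "matrix_inv V" "V *v z"]
    by (simp add: matrix_inv_mult_cancel[OF inv])
  also have "\<dots> \<le> onorm ((*v) (matrix_inv V)) * (onorm ((*v) V) * norm z)"
    by (intro mult_left_mono norm_matrix_vector_le onorm_pos_le matrix_vector_mul_bounded_linear)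
  finally show ?thesis
    using \<open>0 < norm z\<close> by (simp add: cond_def)
qed


section \<open>Contraction between two nodes\<close>

definition eigen_coords :: "complex ^ 'n ^ 'n \<Rightarrow> real ^ 'n \<Rightarrow> complex ^ 'n" where
  "eigen_coords V z = matrix_inv V *v complex_vector z"

lemma bounded_linear_eigen_coords: "bounded_linear (eigen_coords V)"
  unfolding eigen_coords_def
  by (rule bounded_linear_compose[OF matrix_vector_mul_bounded_linear bounded_linear_complex_vector])

lemma norm_eigen_coords_le: "norm (eigen_coords V z) \<le> onorm ((*v) (matrix_inv V)) * norm z"
  unfolding eigen_coords_def by (rule norm_matrix_vector_le[THEN order_trans]) simp

lemma norm_le_eigen_coords:
  assumes "invertible V"
  shows "norm z \<le> onorm ((*v) V) * norm (eigen_coords V z)"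
  using norm_matrix_vector_le[of V "eigen_coords V z"]
  by (simp add: eigen_coords_def mult_matrix_inv_cancel[OF assms])

text \<open>
  The norm of the eigenvector coordinates contracts with constant \<open>1\<close>, whereas estimating
  the Euclidean norm of \<open>z\<close> directly costs a factor \<open>cond V\<close> on every interval.
\<close>

lemma linear_ode_contraction:
  fixes M :: "real ^ 'n ^ 'n" and z :: "real \<Rightarrow> real ^ 'n"
  assumes inv: "invertible V"
    and ev: "\<And>j. eigenvector (complex_matrix M) (\<nu> j) (column j V)"
    and rate: "\<And>j. Re (\<nu> j) \<le> - \<mu>"
    and sol: "solves_on (\<lambda>t z. M *v z) z {a<..<b}"
    and lim: "(z \<longlongrightarrow> za) (at_right a)" and ab: "a < b"
  obtains zb where "(z \<longlongrightarrow> zb) (at_left b)"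
    and "norm (eigen_coords V zb) \<le> exp (- \<mu> * (b - a)) * norm (eigen_coords V za)"
proof -
  interpret K: bounded_linear "eigen_coords V"
    by (rule bounded_linear_eigen_coords)
  obtain E where E: "countable E" and cont: "continuous_on {a<..<b} z"
    and der: "\<And>t. t \<in> {a<..<b} - E \<Longrightarrow> (z has_vector_derivative M *v z t) (at t)"
    using sol by (auto simp: solves_on_def)
  define w where "w t = (\<chi> j. exp (\<nu> j * of_real (t - a)) * eigen_coords V za $ j)" for t
  have coords: "eigen_coords V (z t) = w t" if t: "t \<in> {a<..<b}" for t
  proof -
    have "eigen_coords V (z t) $ j = exp (\<nu> j * of_real (t - a)) * eigen_coords V za $ j" for j
    proof (rule scalar_linear_ode_solution[OF _ E _ _ t])
      interpret Kj: bounded_linear "\<lambda>v. eigen_coords V v $ j"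
        by (rule bounded_linear_compose[OF bounded_linear_vec_nth bounded_linear_eigen_coords])
      show "continuous_on {a<..<b} (\<lambda>t. eigen_coords V (z t) $ j)"
        by (rule Kj.continuous_on[OF cont])
      show "((\<lambda>t. eigen_coords V (z t) $ j) \<longlongrightarrow> eigen_coords V za $ j) (at_right a)"
        by (rule Kj.tendsto[OF lim])
      fix s assume s: "s \<in> {a<..<b} - E"
      have "eigen_coords V (M *v z s) $ j = \<nu> j * eigen_coords V (z s) $ j"
        using eigenvector_coordinates[OF inv ev, where z = "complex_vector (z s)" and j = j]
        by (simp add: eigen_coords_def complex_matrix_mult_complex_vector)
      then show "((\<lambda>t. eigen_coords V (z t) $ j) has_vector_derivative
          \<nu> j * eigen_coords V (z s) $ j) (at s)"
        using Kj.has_vector_derivative[OF der[OF s]] by simp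
    qed
    then show ?thesis
      by (simp add: w_def vec_eq_iff)
  qed
  have z_eq: "z t = (\<chi> i. Re ((V *v w t) $ i))" if "t \<in> {a<..<b}" for t
  proof -
    have "V *v w t = complex_vector (z t)"
      using coords[OF that] mult_matrix_inv_cancel[OF inv] by (metis eigen_coords_def)
    then show ?thesis
      by (simp add: complex_vector_def)
  qed
  define zb where "zb = (\<chi> i. Re ((V *v w b) $ i))"
  have near: "\<forall>\<^sub>F t in at_left b. t \<in> {a<..<b}"
    using ab by (rule eventually_at_left_real)
  have w_lim: "(w \<longlongrightarrow> w b) (at_left b)"
    unfolding w_def by (intro tendsto_intros)
  then have "((\<lambda>t. \<chi> i. Re ((V *v w t) $ i)) \<longlongrightarrow> zb) (at_left b)"
    unfolding zb_def
    by (intro tendsto_intros bounded_linear.tendsto[OF matrix_vector_mul_bounded_linear])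
  then have zb: "(z \<longlongrightarrow> zb) (at_left b)"
    by (rule Lim_transform_eventually) (use near in \<open>eventually_elim, simp add: z_eq\<close>)
  have "((\<lambda>t. eigen_coords V (z t)) \<longlongrightarrow> w b) (at_left b)"
    by (rule Lim_transform_eventually[OF w_lim]) (use near in \<open>eventually_elim, simp add: coords\<close>)
  then have "eigen_coords V zb = w b"
    using K.tendsto[OF zb] by (intro tendsto_unique[of "at_left b"]) auto
  moreover have "norm (w b) \<le> norm (exp (- \<mu> * (b - a)) *\<^sub>R eigen_coords V za)"
  proof (rule norm_le_componentwise_cart)
    fix j
    have "Re (\<nu> j) * (b - a) \<le> - \<mu> * (b - a)"
      using rate ab by (intro mult_right_mono) auto
    then show "norm (w b $ j) \<le> norm ((exp (- \<mu> * (b - a)) *\<^sub>R eigen_coords V za) $ j)"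
      by (simp add: w_def norm_mult mult_right_mono)
  qed
  ultimately show thesis
    using that[OF zb] by simp
qed

text \<open>
  On a subinterval the input cancels in the difference of the two equations, so the error obeys the
  homogeneous equation with matrix \<open>A - L ** C\<close>.
\<close>

lemma observer_error_contraction:
  fixes A :: "real ^ 'm ^ 'm" and C :: "real ^ 'm ^ 'q"
  assumes inv: "invertible V"
    and ev: "\<And>j. eigenvector (complex_matrix (A - L ** C)) (\<nu> j) (column j V)"
    and rate: "\<And>j. Re (\<nu> j) \<le> - \<mu>"
    and sys: "system_solution A B u x0 x" and y: "\<And>t. 0 \<le> t \<Longrightarrow> y t = C *v x t"
    and T: "0 < T" and obs: "parallel_observer A B C L u y T N xh0 X xp"
    and l: "1 \<le> l" and n: "n < N"
  defines "a \<equiv> node T N l n" and "b \<equiv> node T N l (Suc n)"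
  shows "norm (eigen_coords V (x b - Lim (at_left b) xp))
    \<le> exp (- \<mu> * (T / real N)) * norm (eigen_coords V (x a - X l n))"
proof -
  have ba: "b - a = T / real N"
    by (simp add: a_def b_def node_def algebra_simps add_divide_distrib)
  moreover have "0 < T / real N"
    using T n by simp
  ultimately have ab: "a < b"
    by linarith
  have a: "0 \<le> a"
    using T l by (simp add: a_def node_def)
  obtain E where E: "countable E" and contx: "continuous_on {0<..} x"
    and derx: "\<And>t. t \<in> {0<..} - E \<Longrightarrow> (x has_vector_derivative A *v x t + B *v u t) (at t)"
    using sys by (auto simp: system_solution_def solves_on_def)
  have obs_ab: "solves_on (\<lambda>t z. A *v z + B *v u t + L *v (y t - C *v z)) xp {a<..<b} \<and>
      (xp \<longlongrightarrow> X l n) (at_right a)"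
    unfolding a_def b_def
    by (rule obs[unfolded parallel_observer_def, THEN conjunct1, rule_format, OF l n])
  then obtain F where F: "countable F" and contp: "continuous_on {a<..<b} xp"
    and derp: "\<And>t. t \<in> {a<..<b} - F \<Longrightarrow>
      (xp has_vector_derivative A *v xp t + B *v u t + L *v (y t - C *v xp t)) (at t)"
    by (auto simp: solves_on_def)
  have x_cont: "isCont x t" if "0 < t" for t
    using that contx by (auto simp: continuous_on_eq_continuous_at)
  have "(x \<longlongrightarrow> x a) (at_right a)"
  proof (cases "a = 0")
    case True
    then show ?thesis
      using sys by (simp add: system_solution_def)
  next
    case False
    then show ?thesis
      using a x_cont[of a] by (simp add: isCont_def filterlim_at_split)
  qed
  moreover have "(xp \<longlongrightarrow> X l n) (at_right a)"
    using obs_ab by simp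
  ultimately have lim: "((\<lambda>t. x t - xp t) \<longlongrightarrow> x a - X l n) (at_right a)"
    by (rule tendsto_diff)
  have "solves_on (\<lambda>t z. (A - L ** C) *v z) (\<lambda>t. x t - xp t) {a<..<b}"
    unfolding solves_on_def
  proof (intro conjI exI[of _ "E \<union> F"] ballI)
    show "continuous_on {a<..<b} (\<lambda>t. x t - xp t)"
      by (intro continuous_on_diff contp continuous_on_subset[OF contx]) (use a in auto)
    fix t assume t: "t \<in> {a<..<b} - (E \<union> F)"
    have "((\<lambda>t. x t - xp t) has_vector_derivative A *v x t + B *v u t -
        (A *v xp t + B *v u t + L *v (y t - C *v xp t))) (at t)"
      using t a by (intro has_vector_derivative_diff derx derp) auto
    moreover have "A *v x t + B *v u t - (A *v xp t + B *v u t + L *v (y t - C *v xp t))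
        = (A - L ** C) *v (x t - xp t)"
      using y[of t] t a
      by (simp add: matrix_vector_mult_diff_distrib matrix_vector_mult_diff_rdistrib
          matrix_vector_mul_assoc)
    ultimately show "((\<lambda>t. x t - xp t) has_vector_derivative (A - L ** C) *v (x t - xp t)) (at t)"
      by simp
  qed (use E F in auto)
  then obtain zb where zb: "((\<lambda>t. x t - xp t) \<longlongrightarrow> zb) (at_left b)"
    and le: "norm (eigen_coords V zb) \<le> exp (- \<mu> * (b - a)) * norm (eigen_coords V (x a - X l n))"
    by (rule linear_ode_contraction[OF inv ev rate _ lim ab])
  have "(x \<longlongrightarrow> x b) (at_left b)"
    using a ab x_cont[of b] by (simp add: isCont_def filterlim_at_split)
  from tendsto_diff[OF this zb] have "(xp \<longlongrightarrow> x b - zb) (at_left b)"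
    by simp
  then have "Lim (at_left b) xp = x b - zb"
    by (intro tendsto_Lim) auto
  then show ?thesis
    using le by (simp add: ba)
qed


section \<open>Summing the jumps\<close>

lemma decay_with_jumps:
  fixes e d :: "nat \<Rightarrow> real"
  assumes "\<And>n. n < k \<Longrightarrow> e (Suc n) \<le> exp (- c) * e n + d (Suc n)"
  shows "exp (c * real k) * e k \<le> e 0 + (\<Sum>n = 1..k. exp (c * real n) * d n)"
  using assms
proof (induction k)
  case (Suc k)
  have "exp (c * real (Suc k)) * e (Suc k)
      \<le> exp (c * real (Suc k)) * (exp (- c) * e k + d (Suc k))"
    by (intro mult_left_mono Suc.prems) auto
  also have "\<dots> = exp (c * real k) * e k + exp (c * real (Suc k)) * d (Suc k)"
    by (simp add: algebra_simps exp_add exp_minus)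
  finally show ?case
    using Suc by simp
qed simp

text \<open>
  The observer is continuous at both ends of a window, so only the jumps at the interior nodes enter
  the recursion from one end to the other.
\<close>

lemma observer_error_window:
  fixes A :: "real ^ 'm ^ 'm" and C :: "real ^ 'm ^ 'q"
  assumes inv: "invertible V"
    and ev: "\<And>j. eigenvector (complex_matrix (A - L ** C)) (\<nu> j) (column j V)"
    and rate: "\<And>j. Re (\<nu> j) \<le> - \<mu>"
    and sys: "system_solution A B u x0 x" and y: "\<And>t. 0 \<le> t \<Longrightarrow> y t = C *v x t"
    and T: "0 < T" and N: "1 \<le> N" and obs: "parallel_observer A B C L u y T N xh0 X xp"
  defines "e \<equiv> \<lambda>l. norm (eigen_coords V (x (real l * T) - xp (real l * T)))"
  shows "e (Suc l) \<le> exp (- (\<mu> * T)) * e l + exp (- (\<mu> * T)) * (onorm ((*v) (matrix_inv V)) *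
    (\<Sum>n = 1..N - 1. exp (\<mu> * real n * (T / real N)) * norm (jump T N X xp (Suc l) n)))"
proof -
  interpret K: bounded_linear "eigen_coords V"
    by (rule bounded_linear_eigen_coords)
  define k where "k = N - 1"
  have k: "N = Suc k"
    using N by (simp add: k_def)
  define c where "c = \<mu> * (T / real N)"
  define P where "P = onorm ((*v) (matrix_inv V))"
  define J where "J n = norm (jump T N X xp (Suc l) n)" for n
  define f where "f n = norm (eigen_coords V (x (node T N (Suc l) n) - X (Suc l) n))" for n
  define g where "g n = norm (eigen_coords V (x (node T N (Suc l) n) -
    Lim (at_left (node T N (Suc l) n)) xp))" for n
  have gf: "g (Suc n) \<le> exp (- c) * f n" if "n < N" for n
    using observer_error_contraction[OF inv ev rate sys y T obs _ that, of "Suc l"]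
    by (simp add: f_def g_def c_def)
  have fg: "f n \<le> g n + P * J n" for n
  proof -
    let ?t = "node T N (Suc l) n"
    have "x ?t - X (Suc l) n = (x ?t - Lim (at_left ?t) xp) - jump T N X xp (Suc l) n"
      by (simp add: jump_def)
    then have "f n \<le> g n + norm (eigen_coords V (jump T N X xp (Suc l) n))"
      unfolding f_def g_def by (simp only: K.diff norm_triangle_ineq4)
    also have "\<dots> \<le> g n + P * J n"
      unfolding P_def J_def by (intro add_left_mono norm_eigen_coords_le)
    finally show ?thesis .
  qed
  have left: "Lim (at_left (real l * T)) xp = xp (real l * T)" if "1 \<le> l" for l
    using obs that
    by (intro tendsto_Lim) (auto simp: parallel_observer_def isCont_def filterlim_at_split)
  have "X (Suc l) 0 = xp (real l * T)"
  proof (cases "l = 0")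
    case False
    then have "X (Suc l) 0 = Lim (at_left (real l * T)) xp"
      using obs by (auto simp: parallel_observer_def dest!: spec[of _ "Suc l"])
    then show ?thesis
      using False left by simp
  qed (use obs in \<open>auto simp: parallel_observer_def\<close>)
  then have f0: "f 0 = e l"
    by (simp add: f_def e_def node_def)
  have "node T N (Suc l) N = real (Suc l) * T"
    using N by (simp add: node_def algebra_simps)
  then have gN: "g N = e (Suc l)"
    by (simp add: g_def e_def left del: of_nat_Suc)
  have "exp (c * real k) * f k \<le> f 0 + (\<Sum>n = 1..k. exp (c * real n) * (P * J n))"
  proof (rule decay_with_jumps)
    fix n assume "n < k"
    then have "g (Suc n) \<le> exp (- c) * f n"
      using k by (intro gf) simp
    then show "f (Suc n) \<le> exp (- c) * f n + P * J (Suc n)"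
      using fg[of "Suc n"] by linarith
  qed
  then have "exp (- (\<mu> * T)) * (exp (c * real k) * f k)
      \<le> exp (- (\<mu> * T)) * (f 0 + (\<Sum>n = 1..k. exp (c * real n) * (P * J n)))"
    by (intro mult_left_mono) auto
  moreover have "exp (- (\<mu> * T)) * (exp (c * real k) * f k) = exp (- c) * f k"
  proof -
    have "\<mu> * T = c * real N"
      using N by (simp add: c_def)
    also have "\<dots> = c * real k + c"
      by (simp add: k distrib_left)
    finally have "- (\<mu> * T) + c * real k = - c"
      by simp
    then show ?thesis
      by (simp add: exp_add[symmetric] mult.assoc[symmetric])
  qed
  moreover have "(\<Sum>n = 1..k. exp (c * real n) * (P * J n))
      = P * (\<Sum>n = 1..k. exp (\<mu> * real n * (T / real N)) * J n)"
    unfolding sum_distrib_left by (intro sum.cong) (simp_all add: c_def mult_ac)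
  ultimately show ?thesis
    using gf[of k] k f0 gN unfolding P_def J_def by (simp add: distrib_left)
qed

theorem proposition3p2:
  fixes A :: "real ^ 'm ^ 'm" and B :: "real ^ 'p ^ 'm"
    and C :: "real ^ 'm ^ 'q" and L :: "real ^ 'q ^ 'm"
    and V :: "complex ^ 'm ^ 'm"
    and u :: "real \<Rightarrow> real ^ 'p" and y :: "real \<Rightarrow> real ^ 'q"
    and x xp :: "real \<Rightarrow> real ^ 'm" and x0 xh0 :: "real ^ 'm"
    and X :: "nat \<Rightarrow> nat \<Rightarrow> real ^ 'm"
    and T \<mu> \<gamma> \<gamma>' :: real and N :: nat
  assumes "observable A C"
    and "\<forall>\<nu> \<in> spectrum (A - L ** C). \<nu> \<in> \<real> \<and> Re \<nu> < 0 \<and> simple_eigenvalue (A - L ** C) \<nu>"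
    and "invertible V"
    and "\<forall>j. \<exists>\<nu>. eigenvector (complex_matrix (A - L ** C)) \<nu> (column j V)"
    and "\<mu> = Min (cmod ` spectrum (A - L ** C))"
    and "\<gamma> = cond V"
    and "system_solution A B u x0 x"
    and "\<forall>t\<ge>0. y t = C *v x t"
    and "T > 0" and "N \<ge> 1"
    and "parallel_observer A B C L u y T N xh0 X xp"
    and "\<gamma>' > 0"
    and "\<forall>l\<ge>1. \<gamma> * (\<Sum>n = 1..N - 1. exp (\<mu> * real n * (T / real N)) * norm (jump T N X xp l n))
               \<le> \<gamma>' * (exp (- \<mu> * (real l - 1) * T) / 2 ^ l)"
  shows "\<forall>l\<ge>1. norm (x (real l * T) - xp (real l * T))
               \<le> \<gamma> * (norm (x 0 - xh0) + \<gamma>') * exp (- \<mu> * real l * T)"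
proof -
  from assms(4) obtain \<nu> where ev: "\<And>j. eigenvector (complex_matrix (A - L ** C)) (\<nu> j) (column j V)"
    by metis
  note spec = spectrum_eq_range[OF \<open>invertible V\<close> ev]
  \<comment> \<open>Reality of the eigenvalues turns the bound on their moduli into a decay rate.\<close>
  have rate: "Re (\<nu> j) \<le> - \<mu>" for j
  proof -
    have "\<nu> j \<in> \<real>" "Re (\<nu> j) < 0"
      using assms(2) spec by auto
    then have "cmod (\<nu> j) = - Re (\<nu> j)"
      by (auto elim!: Reals_cases)
    moreover have "\<mu> \<le> cmod (\<nu> j)"
      unfolding assms(5) spec by (intro Min_le) auto
    ultimately show ?thesis
      by simp
  qed
  define v where "v = onorm ((*v) V)"
  define P where "P = onorm ((*v) (matrix_inv V))"
  have v: "0 \<le> v"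
    unfolding v_def by (intro onorm_pos_le matrix_vector_mul_bounded_linear)
  have \<gamma>: "\<gamma> = P * v" "1 \<le> \<gamma>"
    using cond_ge_1[OF \<open>invertible V\<close>] by (simp_all add: assms(6) cond_def P_def v_def)
  define e where "e l = norm (eigen_coords V (x (real l * T) - xp (real l * T)))" for l
  define S where "S l = (\<Sum>n = 1..N - 1. exp (\<mu> * real n * (T / real N)) * norm (jump T N X xp l n))"
    for l
  have step: "e (Suc l) \<le> exp (- (\<mu> * T)) * e l + exp (- (\<mu> * T)) * (P * S (Suc l))" for l
    unfolding e_def P_def S_def
    by (rule observer_error_window[OF \<open>invertible V\<close> ev rate assms(7) _ assms(9-11)])
      (use assms(8) in auto)
  \<comment> \<open>Window \<open>k\<close> carries the weight \<open>exp (\<mu> * (k - 1) * T)\<close> of its left end, which is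
    exactly what the hypothesis on the jumps cancels.\<close>
  have jumps: "v * (exp (\<mu> * T * real k) * (exp (- (\<mu> * T)) * (P * S k))) \<le> \<gamma>' * (1 / 2) ^ k"
    if "1 \<le> k" for k
  proof -
    have "\<gamma> * S k \<le> \<gamma>' * (exp (- \<mu> * (real k - 1) * T) / 2 ^ k)"
      using assms(13) that by (simp add: S_def)
    then have "exp (\<mu> * (real k - 1) * T) * (\<gamma> * S k)
        \<le> exp (\<mu> * (real k - 1) * T) * (\<gamma>' * (exp (- \<mu> * (real k - 1) * T) / 2 ^ k))"
      by (intro mult_left_mono) auto
    also have "\<dots> = \<gamma>' * (1 / 2) ^ k"
      by (simp add: exp_minus power_divide)
    also have "exp (\<mu> * (real k - 1) * T) = exp (\<mu> * T * real k) * exp (- (\<mu> * T))"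
      by (simp add: exp_add[symmetric] algebra_simps)
    finally show ?thesis
      by (simp add: \<gamma>(1) mult_ac)
  qed
  show ?thesis
  proof (intro allI impI)
    fix l :: nat
    have "v * (exp (\<mu> * T * real l) * e l)
        \<le> v * (e 0 + (\<Sum>k = 1..l. exp (\<mu> * T * real k) * (exp (- (\<mu> * T)) * (P * S k))))"
      using step by (intro mult_left_mono decay_with_jumps v) auto
    also have "\<dots> \<le> v * e 0 + (\<Sum>k = 1..l. \<gamma>' * (1 / 2) ^ k)"
      unfolding distrib_left sum_distrib_left using jumps by (intro add_left_mono sum_mono) auto
    also have "v * e 0 \<le> \<gamma> * norm (x 0 - xh0)"
    proof -
      have "xp 0 = xh0"
        using assms(11) by (simp add: parallel_observer_def)
      then show ?thesis
        using mult_left_mono[OF norm_eigen_coords_le v, of V "x 0 - xp 0"]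
        by (simp add: e_def \<gamma>(1) P_def mult_ac)
    qed
    also have "(\<Sum>k = 1..l. \<gamma>' * (1 / 2) ^ k) \<le> \<gamma> * \<gamma>'"
    proof -
      have "(\<Sum>k = 1..l. (1 / 2 :: real) ^ k) = 1 - (1 / 2) ^ l"
        by (induction l) (simp_all add: field_simps)
      also have "\<dots> \<le> \<gamma>"
        using \<gamma>(2) zero_le_power[of "1 / 2 :: real" l] by linarith
      finally show ?thesis
        using assms(12) by (simp add: sum_distrib_left[symmetric] mult.commute)
    qed
    finally have "exp (\<mu> * T * real l) * (v * e l) \<le> \<gamma> * (norm (x 0 - xh0) + \<gamma>')"
      by (simp add: algebra_simps)
    then have "v * e l \<le> \<gamma> * (norm (x 0 - xh0) + \<gamma>') * exp (- \<mu> * real l * T)"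
      by (simp add: exp_minus field_simps)
    then show "norm (x (real l * T) - xp (real l * T))
        \<le> \<gamma> * (norm (x 0 - xh0) + \<gamma>') * exp (- \<mu> * real l * T)"
      using norm_le_eigen_coords[OF \<open>invertible V\<close>, of "x (real l * T) - xp (real l * T)"]
      by (simp add: e_def v_def)
  qed
qed

end
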